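(* Let $d\ge 2$, let $\mathcal F=(G,\Gamma,p,\pi)$ be a periodic framework in $\mathbb R^d$ with $n$ vertex orbits, and let $(\dot q_1,\dots,\dot q_{n-1},\dot\omega)$ be a strictly auxetic infinitesimal deformation of $\mathcal F$ (in lattice coordinates, with Gram matrix $\omega$ and $\dot q_0=0$). Then: (a) The quotient multigraph $G/\Gamma$ has no loops. (b) For every pair $i\ne j$ of vertex orbits connected by at least one edge orbit, all edge vectors $e_{ij}$ (in lattice coordinates) from the orbit of $v_i$ to the orbit of $v_j$, when placed with origin at $0$, have their endpoints on the ellipsoid $$\{x\in\mathbb R^d:\ \langle\dot\omega x,x\rangle+2\langle\omega(\dot q_j-\dot q_i),x\rangle=0\},$$ which passes through $x=0$ and has center $c_{ij}=\dot\omega^{-1}\omega(\dot q_i-\dot q_j)$. All these ellipsoids, indexed by the edges $ij$ of the reduced quotient graph, are homothetic to each other. (c) For every cycle $i_1,i_2,\dots,i_J,i_1$ in the reduced quotient graph, $c_{i_1i_2}+c_{i_2i_3}+\dots+c_{i_Ji_1}=0$.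
   Context: A $d$-periodic graph is a pair $(G,\Gamma)$, where $G=(V,E)$ is a connected simple infinite graph with finite degree at every vertex, and $\Gamma\subset \mathrm{Aut}(G)$ is a free Abelian group of rank $d$ acting without fixed points and with finitely many vertex orbits. The quotient multigraph is $G/\Gamma=(V/\Gamma,E/\Gamma)$; the reduced quotient graph is obtained from it by replacing multiple edges by simple edges. A periodic framework $\mathcal F=(G,\Gamma,p,\pi)$ in $\mathbb R^d$ is a $d$-periodic graph with a map $p:V\to\mathbb R^d$ and an injective homomorphism $\pi$ from $\Gamma$ to the group of translations of $\mathbb R^d$ whose image is a lattice of rank $d$, such that $p(\gamma v)=\pi(\gamma)(p(v))$. Edges are represented as straight segments between the positions of their endpoints; these segments are understood to be nondegenerate, i.e. adjacent vertices have distinct positions. Choose $d$ independent generators of $\Gamma$ and let $\Lambda$ be the $d\times d$ matrix whose columns are the translation vectors of their images under $\pi$; the Gram matrix is $\omega=\Lambda^t\Lambda$. Choose representatives $v_0,\dots,v_{n-1}$ of the vertex orbits, put $p_i=p(v_i)$, and define lattice coordinates by $q_0=0$, $\Lambda q_i=p_i-p_0$. An edge going from $v_i$ to a vertex in the orbit of $v_j$ has Cartesian edge vector $p_j+\Lambda n_{ij}-p_i$ for some $n_{ij}\in\mathbb Z^d$; in lattice coordinates its edge vector is $e_{ij}=q_j+n_{ij}-q_i$. (Several edge orbits may join the orbits of $v_i$ and $v_j$, giving several vectors $e_{ij}$.) An infinitesimal deformation of $\mathcal F$ is a tuple $(\dot q_1,\dots,\dot q_{n-1},\dot\omega)$, with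 $\dot q_i\in\mathbb R^d$, $\dot q_0=0$, and $\dot\omega$ a symmetric real $d\times d$ matrix, such that for every edge vector $e_{ij}$ (all edge orbits, including possible loops $i=j$) $$\langle\dot\omega e_{ij},e_{ij}\rangle+2\langle\omega(\dot q_j-\dot q_i),e_{ij}\rangle=0 .$$ It is strictly auxetic if $\dot\omega$ is positive definite. Two ellipsoids are homothetic if one is the image of the other under a map $x\mapsto ax+b$ with $a>0$, $b\in\mathbb R^d$. *)

theory Defs
  imports
    "HOL-Analysis.Analysis"
    "HOL-Algebra.Group_Action"
    "HOL-Algebra.Generated_Groups"
    "HOL-Algebra.Free_Abelian_Groups"
begin

section \<open>Periodic graphs and their quotients\<close>

text \<open>An edge is a two-element set of vertices.\<close>

definition adjacent :: "'v set set \<Rightarrow> 'v \<Rightarrow> 'v \<Rightarrow> bool" where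
  "adjacent E u v \<longleftrightarrow> {u, v} \<in> E"

locale simple_graph =
  fixes V :: "'v set" and E :: "'v set set"
  assumes edges: "E \<subseteq> {{u, v} | u v. u \<in> V \<and> v \<in> V \<and> u \<noteq> v}"

text \<open>As in \<^const>\<open>BijGroup\<close>, automorphisms are extensional functions on \<open>V\<close>.\<close>

definition graph_Aut :: "'v set \<Rightarrow> 'v set set \<Rightarrow> ('v \<Rightarrow> 'v) monoid" where
  "graph_Aut V E = BijGroup V
     \<lparr>carrier := {f \<in> Bij V. \<forall>u\<in>V. \<forall>v\<in>V. adjacent E (f u) (f v) \<longleftrightarrow> adjacent E u v}\<rparr>"

text \<open>The group structure on a set \<open>\<Gamma>\<close> of permutations of \<open>V\<close>.\<close>

definition perm_group :: "'v set \<Rightarrow> ('v \<Rightarrow> 'v) set \<Rightarrow> ('v \<Rightarrow> 'v) monoid" where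
  "perm_group V \<Gamma> = BijGroup V \<lparr>carrier := \<Gamma>\<rparr>"

definition vertex_orbit :: "'v set \<Rightarrow> ('v \<Rightarrow> 'v) set \<Rightarrow> 'v \<Rightarrow> 'v set" where
  "vertex_orbit V \<Gamma> v = orbit (perm_group V \<Gamma>) (\<lambda>\<gamma>. \<gamma>) v"

definition vertex_orbits :: "'v set \<Rightarrow> ('v \<Rightarrow> 'v) set \<Rightarrow> 'v set set" where
  "vertex_orbits V \<Gamma> = orbits (perm_group V \<Gamma>) V (\<lambda>\<gamma>. \<gamma>)"

definition edge_orbits ::
    "'v set \<Rightarrow> 'v set set \<Rightarrow> ('v \<Rightarrow> 'v) set \<Rightarrow> 'v set set set" where
  "edge_orbits V E \<Gamma> = orbits (perm_group V \<Gamma>) E (\<lambda>\<gamma> e. \<gamma> ` e)"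

locale periodic_graph = simple_graph V E
  for V :: "'v set" and E :: "'v set set" +
  fixes d :: nat and \<Gamma> :: "('v \<Rightarrow> 'v) set"
  assumes infinite_vertices: "infinite V"
    and connected: "\<And>u v. u \<in> V \<Longrightarrow> v \<in> V \<Longrightarrow> (adjacent E)\<^sup>*\<^sup>* u v"
    and finite_degree: "\<And>v. v \<in> V \<Longrightarrow> finite {w. adjacent E v w}"
    and automorphisms: "subgroup \<Gamma> (graph_Aut V E)"
    and free_abelian: "perm_group V \<Gamma> \<cong> free_Abelian_group {..<d}"
    and no_fixed_points:
      "\<And>\<gamma> v. \<gamma> \<in> \<Gamma> \<Longrightarrow> v \<in> V \<Longrightarrow> \<gamma> v = v \<Longrightarrow> \<gamma> = \<one>\<^bsub>perm_group V \<Gamma>\<^esub>"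
    and finitely_many_orbits: "finite (vertex_orbits V \<Gamma>)"

text \<open>Each edge of a multigraph has a set of one or two ends; it is a loop if there is only one.\<close>

record ('a, 'b) multigraph =
  mverts :: "'a set"
  medges :: "'b set"
  ends :: "'b \<Rightarrow> 'a set"

definition is_loop :: "('a, 'b) multigraph \<Rightarrow> 'b \<Rightarrow> bool" where
  "is_loop Q e \<longleftrightarrow> e \<in> medges Q \<and> card (ends Q e) = 1"

definition quotient_multigraph ::
    "'v set \<Rightarrow> 'v set set \<Rightarrow> ('v \<Rightarrow> 'v) set \<Rightarrow> ('v set, 'v set set) multigraph" where
  "quotient_multigraph V E \<Gamma> =
     \<lparr>mverts = vertex_orbits V \<Gamma>,
      medges = edge_orbits V E \<Gamma>,
      ends = (\<lambda>\<epsilon>. vertex_orbit V \<Gamma> ` \<Union>\<epsilon>)\<rparr>"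

text \<open>Parallel edges of the quotient multigraph have the same set of ends and so are identified.\<close>

definition reduced_quotient_edges ::
    "'v set \<Rightarrow> 'v set set \<Rightarrow> ('v \<Rightarrow> 'v) set \<Rightarrow> 'v set set set" where
  "reduced_quotient_edges V E \<Gamma> =
     ends (quotient_multigraph V E \<Gamma>) ` medges (quotient_multigraph V E \<Gamma>)"

text \<open>Cycles \<open>x\<^sub>1, \<dots>, x\<^sub>J, x\<^sub>1\<close>, given by the list of the first \<open>J\<close> vertices.
  Repeated vertices are allowed, so simple cycles are included.\<close>

definition is_cycle :: "'a set set \<Rightarrow> 'a list \<Rightarrow> bool" where
  "is_cycle R xs \<longleftrightarrow> xs \<noteq> [] \<and>
     (\<forall>k < length xs. adjacent R (xs ! k) (xs ! (Suc k mod length xs)))"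


section \<open>Periodic frameworks\<close>

definition translation_group :: "('a::ab_group_add \<Rightarrow> 'a) monoid" where
  "translation_group = BijGroup UNIV \<lparr>carrier := range (\<lambda>t x. x + t)\<rparr>"

definition translation_vector :: "('a::ab_group_add \<Rightarrow> 'a) \<Rightarrow> 'a" where
  "translation_vector T = T 0"

definition is_lattice :: "(real ^ 'd) set \<Rightarrow> bool" where
  "is_lattice L \<longleftrightarrow> (\<exists>B :: 'd::finite \<Rightarrow> real ^ 'd. inj B \<and> independent (range B) \<and>
     L = {\<Sum>k\<in>UNIV. of_int (z k) *\<^sub>R B k | z :: 'd \<Rightarrow> int. True})"

locale periodic_framework = periodic_graph V E "CARD('d)" \<Gamma>
  for V :: "'v set" and E :: "'v set set" and \<Gamma> :: "('v \<Rightarrow> 'v) set" +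
  fixes p :: "'v \<Rightarrow> real ^ 'd::finite"
    and \<pi> :: "('v \<Rightarrow> 'v) \<Rightarrow> (real ^ 'd \<Rightarrow> real ^ 'd)"
  assumes injective_hom: "\<pi> \<in> mon (perm_group V \<Gamma>) translation_group"
    and lattice: "is_lattice (translation_vector ` \<pi> ` \<Gamma>)"
    and equivariant: "\<And>\<gamma> v. \<gamma> \<in> \<Gamma> \<Longrightarrow> v \<in> V \<Longrightarrow> p (\<gamma> v) = \<pi> \<gamma> (p v)"
    and nondegenerate: "\<And>u v. adjacent E u v \<Longrightarrow> p u \<noteq> p v"

definition orbit_representatives ::
    "'v set \<Rightarrow> ('v \<Rightarrow> 'v) set \<Rightarrow> nat \<Rightarrow> (nat \<Rightarrow> 'v) \<Rightarrow> bool" where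
  "orbit_representatives V \<Gamma> n rep \<longleftrightarrow> rep ` {..<n} \<subseteq> V \<and>
     bij_betw (\<lambda>i. vertex_orbit V \<Gamma> (rep i)) {..<n} (vertex_orbits V \<Gamma>)"

text \<open>The orbits of \<open>rep i\<close> and \<open>rep j\<close> are distinct and joined by at least one edge orbit.\<close>

definition linked ::
    "'v set \<Rightarrow> 'v set set \<Rightarrow> ('v \<Rightarrow> 'v) set \<Rightarrow> nat \<Rightarrow> (nat \<Rightarrow> 'v) \<Rightarrow> nat \<Rightarrow> nat \<Rightarrow> bool" where
  "linked V E \<Gamma> n rep i j \<longleftrightarrow> i < n \<and> j < n \<and> i \<noteq> j \<and>
     adjacent (reduced_quotient_edges V E \<Gamma>)
       (vertex_orbit V \<Gamma> (rep i)) (vertex_orbit V \<Gamma> (rep j))"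

definition independent_generators ::
    "'v set \<Rightarrow> ('v \<Rightarrow> 'v) set \<Rightarrow> ('d::finite \<Rightarrow> 'v \<Rightarrow> 'v) \<Rightarrow> bool" where
  "independent_generators V \<Gamma> g \<longleftrightarrow>
     range g \<subseteq> \<Gamma> \<and> generate (perm_group V \<Gamma>) (range g) = \<Gamma> \<and>
     (\<forall>z :: 'd \<Rightarrow> int.
        finprod (perm_group V \<Gamma>) (\<lambda>k. g k [^]\<^bsub>perm_group V \<Gamma>\<^esub> z k) UNIV = \<one>\<^bsub>perm_group V \<Gamma>\<^esub>
        \<longrightarrow> (\<forall>k. z k = 0))"

definition lattice_matrix ::
    "(('v \<Rightarrow> 'v) \<Rightarrow> real ^ 'd \<Rightarrow> real ^ 'd) \<Rightarrow> ('d \<Rightarrow> 'v \<Rightarrow> 'v) \<Rightarrow> real ^ 'd ^ 'd" where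
  "lattice_matrix \<pi> g = (\<chi> r c. translation_vector (\<pi> (g c)) $ r)"

definition lattice_coordinates ::
    "nat \<Rightarrow> real ^ 'd ^ 'd \<Rightarrow> ('v \<Rightarrow> real ^ 'd) \<Rightarrow> (nat \<Rightarrow> 'v) \<Rightarrow> (nat \<Rightarrow> real ^ 'd::finite) \<Rightarrow> bool" where
  "lattice_coordinates n \<Lambda> p rep q \<longleftrightarrow>
     q 0 = 0 \<and> (\<forall>i<n. \<Lambda> *v q i = p (rep i) - p (rep 0))"

text \<open>The vectors \<open>e\<^sub>i\<^sub>j\<close>, in lattice coordinates, of all edges going from \<open>rep i\<close> to
  a vertex \<open>w\<close> in the orbit of \<open>rep j\<close>.\<close>

definition edge_vectors ::
    "'v set \<Rightarrow> 'v set set \<Rightarrow> ('v \<Rightarrow> 'v) set \<Rightarrow> ('v \<Rightarrow> real ^ 'd) \<Rightarrow> real ^ 'd ^ 'd \<Rightarrow>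
     (nat \<Rightarrow> 'v) \<Rightarrow> (nat \<Rightarrow> real ^ 'd::finite) \<Rightarrow> nat \<Rightarrow> nat \<Rightarrow> (real ^ 'd) set" where
  "edge_vectors V E \<Gamma> p \<Lambda> rep q i j =
     {q j + m - q i | m w.
        (\<forall>k. m $ k \<in> \<int>) \<and> w \<in> vertex_orbit V \<Gamma> (rep j) \<and> adjacent E (rep i) w \<and>
        p w - p (rep i) = p (rep j) + \<Lambda> *v m - p (rep i)}"


section \<open>Infinitesimal deformations\<close>

definition symmetric_matrix :: "real ^ 'd ^ 'd \<Rightarrow> bool" where
  "symmetric_matrix A \<longleftrightarrow> transpose A = A"

definition positive_definite :: "real ^ 'd ^ 'd::finite \<Rightarrow> bool" where
  "positive_definite A \<longleftrightarrow> symmetric_matrix A \<and> (\<forall>x. x \<noteq> 0 \<longrightarrow> (A *v x) \<bullet> x > 0)"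

text \<open>Here \<open>n\<close> is the number of vertex orbits, \<open>e i j\<close> is the set of edge vectors from orbit \<open>i\<close> to
  orbit \<open>j\<close>, and \<open>q'\<close>, \<open>\<omega>'\<close> are the infinitesimal variations of \<open>q\<close>, \<open>\<omega>\<close>.\<close>

definition infinitesimal_deformation ::
    "nat \<Rightarrow> (nat \<Rightarrow> nat \<Rightarrow> (real ^ 'd) set) \<Rightarrow> real ^ 'd ^ 'd \<Rightarrow>
     (nat \<Rightarrow> real ^ 'd::finite) \<Rightarrow> real ^ 'd ^ 'd \<Rightarrow> bool" where
  "infinitesimal_deformation n e \<omega> q' \<omega>' \<longleftrightarrow>
     q' 0 = 0 \<and> symmetric_matrix \<omega>' \<and>
     (\<forall>i<n. \<forall>j<n. \<forall>x \<in> e i j. (\<omega>' *v x) \<bullet> x + 2 * ((\<omega> *v (q' j - q' i)) \<bullet> x) = 0)"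

definition strictly_auxetic ::
    "nat \<Rightarrow> (nat \<Rightarrow> nat \<Rightarrow> (real ^ 'd) set) \<Rightarrow> real ^ 'd ^ 'd \<Rightarrow>
     (nat \<Rightarrow> real ^ 'd::finite) \<Rightarrow> real ^ 'd ^ 'd \<Rightarrow> bool" where
  "strictly_auxetic n e \<omega> q' \<omega>' \<longleftrightarrow>
     infinitesimal_deformation n e \<omega> q' \<omega>' \<and> positive_definite \<omega>'"

definition edge_ellipsoid ::
    "real ^ 'd ^ 'd \<Rightarrow> (nat \<Rightarrow> real ^ 'd::finite) \<Rightarrow> real ^ 'd ^ 'd \<Rightarrow> nat \<Rightarrow> nat \<Rightarrow> (real ^ 'd) set" where
  "edge_ellipsoid \<omega> q' \<omega>' i j =
     {x. (\<omega>' *v x) \<bullet> x + 2 * ((\<omega> *v (q' j - q' i)) \<bullet> x) = 0}"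

definition edge_center ::
    "real ^ 'd ^ 'd \<Rightarrow> (nat \<Rightarrow> real ^ 'd::finite) \<Rightarrow> real ^ 'd ^ 'd \<Rightarrow> nat \<Rightarrow> nat \<Rightarrow> real ^ 'd" where
  "edge_center \<omega> q' \<omega>' i j = matrix_inv \<omega>' *v (\<omega> *v (q' i - q' j))"

text \<open>Ellipsoids are nondegenerate hypersurfaces (not solid bodies).\<close>

definition is_ellipsoid :: "(real ^ 'd) set \<Rightarrow> real ^ 'd::finite \<Rightarrow> bool" where
  "is_ellipsoid S c \<longleftrightarrow>
     (\<exists>A. positive_definite A \<and> S = {x. (A *v (x - c)) \<bullet> (x - c) = 1})"

definition homothetic :: "'a::real_vector set \<Rightarrow> 'a set \<Rightarrow> bool" where
  "homothetic S T \<longleftrightarrow> (\<exists>a>0. \<exists>b. T = (\<lambda>x. a *\<^sub>R x + b) ` S)"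

end

theory Submission
  imports Defs
begin

text \<open>
  A strictly auxetic deformation makes every edge vector \<open>x\<close> satisfy an equation whose quadratic
  part \<open>\<langle>\<omega>' x, x\<rangle>\<close> is the same positive definite form for all edges; only the linear part depends on
  the pair of orbits \<open>i\<close>, \<open>j\<close>. Completing the square turns the solution set into the level set
  \<open>\<langle>\<omega>' (x - c), x - c\<rangle> = \<langle>\<omega>' c, c\<rangle>\<close> of that form around the center \<open>c\<close> (lemma
  \<open>edge_ellipsoid_eq_quadric\<close>). Level sets of one form differ only by translation and scaling, so
  the ellipsoids are homothetic as soon as they are not reduced to a point, that is, \<open>c \<noteq> 0\<close>.

  Both the absence of loops and this nondegeneracy come from one fact, \<open>ex_nonzero_edge_vector\<close>:
  an edge of the graph between two orbits can be moved by \<open>\<Gamma>\<close> so that it starts at the chosen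
  representative, and its lattice coordinates then form a nonzero edge vector, because adjacent
  vertices have distinct positions. For a loop the linear part vanishes and positive
  definiteness is contradicted by such a vector; for two distinct orbits joined by an edge, the
  linear part cannot vanish, for the same reason.

  Finally \<open>c\<^sub>i\<^sub>j = f i - f j\<close> with \<open>f i = \<omega>'\<^sup>-\<^sup>1 \<omega> q'\<^sub>i\<close>, so sums around closed walks telescope.
\<close>

section \<open>The periodicity group acting on vertices\<close>

context periodic_graph
begin

lemma subgroup_graph_Aut: "subgroup (carrier (graph_Aut V E)) (BijGroup V)"
proof -
  let ?A = "carrier (graph_Aut V E)"
  have sub: "?A \<subseteq> Bij V"
    by (auto simp: graph_Aut_def)
  interpret B: group "BijGroup V" by (rule group_BijGroup)
  show ?thesis
  proof (rule B.subgroupI)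
    show "?A \<subseteq> carrier (BijGroup V)"
      using sub by (simp add: BijGroup_def)
    show "?A \<noteq> {}"
      using id_Bij[of V] by (auto simp: graph_Aut_def intro!: exI[of _ "\<lambda>x\<in>V. x"])
  next
    fix f assume f: "f \<in> ?A"
    then have b: "f \<in> Bij V" using sub by blast
    let ?h = "inv_into V f"
    have h: "?h x \<in> V" "f (?h x) = x" if "x \<in> V" for x
      using b that Bij_inv_into_mem[OF b that] f_inv_into_f[of x f V]
      by (auto simp: Bij_def bij_betw_def)
    have "adjacent E (?h u) (?h v) \<longleftrightarrow> adjacent E u v" if "u \<in> V" "v \<in> V" for u v
    proof -
      have "adjacent E (f (?h u)) (f (?h v)) \<longleftrightarrow> adjacent E (?h u) (?h v)"
        using f h(1)[OF that(1)] h(1)[OF that(2)] unfolding graph_Aut_def by simp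
      then show ?thesis
        using h(2)[OF that(1)] h(2)[OF that(2)] by simp
    qed
    then show "inv\<^bsub>BijGroup V\<^esub> f \<in> ?A"
      using restrict_inv_into_Bij[OF b] by (simp add: inv_BijGroup[OF b] graph_Aut_def)
  next
    fix f g assume fg: "f \<in> ?A" "g \<in> ?A"
    then have b: "f \<in> Bij V" "g \<in> Bij V" using sub by blast+
    have "g u \<in> V" if "u \<in> V" for u
      using Bij_imp_funcset[OF b(2)] that by blast
    then show "f \<otimes>\<^bsub>BijGroup V\<^esub> g \<in> ?A"
      using fg b compose_Bij[OF b] by (simp add: BijGroup_def graph_Aut_def compose_eq)
  qed
qed

lemma subgroup_BijGroup: "subgroup \<Gamma> (BijGroup V)"
proof -
  have "graph_Aut V E = BijGroup V\<lparr>carrier := carrier (graph_Aut V E)\<rparr>"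
    by (simp add: graph_Aut_def)
  then show ?thesis
    using group.incl_subgroup[OF group_BijGroup subgroup_graph_Aut] automorphisms by metis
qed

lemma group_perm_group: "group (perm_group V \<Gamma>)"
  unfolding perm_group_def by (rule group.subgroup_imp_group[OF group_BijGroup subgroup_BijGroup])

lemma carrier_perm_group [simp]: "carrier (perm_group V \<Gamma>) = \<Gamma>"
  by (simp add: perm_group_def)

lemma group_action_perm_group: "group_action (perm_group V \<Gamma>) V (\<lambda>\<gamma>. \<gamma>)"
proof -
  have "(\<lambda>\<gamma>. \<gamma>) \<in> hom (perm_group V \<Gamma>) (BijGroup V)"
    using subgroup.subset[OF subgroup_BijGroup] by (auto simp: hom_def perm_group_def)
  then show ?thesis
    unfolding group_action_def group_hom_def group_hom_axioms_def
    using group_perm_group group_BijGroup by blast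
qed

sublocale action: group_action "perm_group V \<Gamma>" V "\<lambda>\<gamma>. \<gamma>"
  by (rule group_action_perm_group)

lemma mem_vertex_orbit_iff: "w \<in> vertex_orbit V \<Gamma> v \<longleftrightarrow> (\<exists>\<gamma>\<in>\<Gamma>. w = \<gamma> v)"
  by (auto simp: vertex_orbit_def orbit_def)

lemma action_closed: "\<gamma> \<in> \<Gamma> \<Longrightarrow> v \<in> V \<Longrightarrow> \<gamma> v \<in> V"
  using action.element_image by simp

lemma vertex_orbit_self: "v \<in> V \<Longrightarrow> v \<in> vertex_orbit V \<Gamma> v"
  using action.orbit_refl by (simp add: vertex_orbit_def)

lemma vertex_orbit_action:
  assumes "\<gamma> \<in> \<Gamma>" "v \<in> V"
  shows "vertex_orbit V \<Gamma> (\<gamma> v) = vertex_orbit V \<Gamma> v"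
proof -
  have "\<gamma> v \<in> V" and "\<gamma> v \<in> vertex_orbit V \<Gamma> v"
    using assms action_closed by (auto simp: mem_vertex_orbit_iff)
  then have "\<gamma> v \<in> vertex_orbit V \<Gamma> v \<inter> vertex_orbit V \<Gamma> (\<gamma> v)"
    using vertex_orbit_self by blast
  moreover have "vertex_orbit V \<Gamma> v \<in> orbits (perm_group V \<Gamma>) V (\<lambda>\<gamma>. \<gamma>)"
    "vertex_orbit V \<Gamma> (\<gamma> v) \<in> orbits (perm_group V \<Gamma>) V (\<lambda>\<gamma>. \<gamma>)"
    using assms \<open>\<gamma> v \<in> V\<close> by (auto simp: orbits_def vertex_orbit_def)
  ultimately show ?thesis
    using action.disjoint_union by blast
qed

lemma adjacent_in_V:
  assumes "adjacent E u v"
  shows "u \<in> V" "v \<in> V"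
  using assms edges by (auto simp: adjacent_def doubleton_eq_iff dest!: subsetD)

lemma adjacent_action:
  assumes "\<gamma> \<in> \<Gamma>" "adjacent E u v"
  shows "adjacent E (\<gamma> u) (\<gamma> v)"
  using assms adjacent_in_V[OF assms(2)] subgroup.subset[OF automorphisms]
  by (auto simp: graph_Aut_def)

text \<open>Any single edge of an edge orbit already shows both ends, since the other edges of the orbit
  are its translates.\<close>

lemma edge_orbit_ends:
  assumes "\<epsilon> \<in> edge_orbits V E \<Gamma>"
  obtains u v where "adjacent E u v"
    and "ends (quotient_multigraph V E \<Gamma>) \<epsilon> = {vertex_orbit V \<Gamma> u, vertex_orbit V \<Gamma> v}"
proof -
  obtain c where c: "c \<in> E" and \<epsilon>: "\<epsilon> = {\<gamma> ` c | \<gamma>. \<gamma> \<in> \<Gamma>}"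
    using assms by (auto simp: edge_orbits_def orbits_def orbit_def)
  obtain u v where uv: "c = {u, v}" "u \<in> V" "v \<in> V"
    using c edges by blast
  have 1: "vertex_orbit V \<Gamma> ` (\<gamma> ` c) = {vertex_orbit V \<Gamma> u, vertex_orbit V \<Gamma> v}"
    if "\<gamma> \<in> \<Gamma>" for \<gamma>
    using that uv vertex_orbit_action by simp
  have "\<Gamma> \<noteq> {}"
    using subgroup.one_closed[OF automorphisms] by (metis empty_iff)
  have "vertex_orbit V \<Gamma> ` \<Union>\<epsilon> = (\<Union>\<gamma>\<in>\<Gamma>. vertex_orbit V \<Gamma> ` (\<gamma> ` c))"
    unfolding \<epsilon> by auto
  also have "\<dots> = {vertex_orbit V \<Gamma> u, vertex_orbit V \<Gamma> v}"
    using 1 \<open>\<Gamma> \<noteq> {}\<close> by simp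
  finally have "vertex_orbit V \<Gamma> ` \<Union>\<epsilon> = {vertex_orbit V \<Gamma> u, vertex_orbit V \<Gamma> v}" .
  moreover have "adjacent E u v"
    using c uv by (simp add: adjacent_def)
  ultimately show ?thesis
    using that by (simp add: quotient_multigraph_def)
qed

end


section \<open>Lattice coordinates of edges\<close>

context periodic_framework
begin

definition shift :: "('v \<Rightarrow> 'v) \<Rightarrow> real ^ 'd" where
  "shift \<gamma> = translation_vector (\<pi> \<gamma>)"

lemma \<pi>_eq_shift:
  assumes "\<gamma> \<in> \<Gamma>"
  shows "\<pi> \<gamma> x = x + shift \<gamma>"
proof -
  have "\<pi> \<gamma> \<in> range (\<lambda>t x. x + t)"
    using injective_hom assms by (force simp: mon_def hom_def translation_group_def)
  then show ?thesis
    by (auto simp: shift_def translation_vector_def)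
qed

lemma p_action: "\<gamma> \<in> \<Gamma> \<Longrightarrow> v \<in> V \<Longrightarrow> p (\<gamma> v) = p v + shift \<gamma>"
  by (simp add: equivariant \<pi>_eq_shift)

lemma shift_mult:
  assumes "\<gamma> \<in> \<Gamma>" "\<delta> \<in> \<Gamma>"
  shows "shift (\<gamma> \<otimes>\<^bsub>perm_group V \<Gamma>\<^esub> \<delta>) = shift \<gamma> + shift \<delta>"
proof -
  obtain v where v: "v \<in> V"
    using infinite_vertices by (metis finite.emptyI ex_in_conv)
  have "\<gamma> \<otimes>\<^bsub>perm_group V \<Gamma>\<^esub> \<delta> \<in> \<Gamma>"
    using monoid.m_closed[OF group.is_monoid[OF group_perm_group]] assms by simp
  then have "p v + shift (\<gamma> \<otimes>\<^bsub>perm_group V \<Gamma>\<^esub> \<delta>) = p (\<gamma> (\<delta> v))"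
    using action.composition_rule[of v \<gamma> \<delta>] v assms by (simp add: p_action[symmetric])
  also have "\<dots> = p v + (shift \<gamma> + shift \<delta>)"
    using v assms by (simp add: p_action action_closed)
  finally show ?thesis by simp
qed

text \<open>Columns of the lattice matrix are the shifts of the generators, and shifts are additive; this
  is where the generators being a generating set of the whole of \<open>\<Gamma>\<close> matters.\<close>

lemma shift_in_lattice:
  assumes "independent_generators V \<Gamma> g" and "\<gamma> \<in> \<Gamma>"
  obtains m where "\<forall>k. m $ k \<in> \<int>" and "shift \<gamma> = lattice_matrix \<pi> g *v m"
proof -
  let ?G = "perm_group V \<Gamma>" and ?\<Lambda> = "lattice_matrix \<pi> g"
  interpret G: group ?G by (rule group_perm_group)
  have gens: "range g \<subseteq> \<Gamma>" "\<gamma> \<in> generate ?G (range g)"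
    using assms by (auto simp: independent_generators_def)
  have one: "shift \<one>\<^bsub>?G\<^esub> = 0"
    using shift_mult[of "\<one>\<^bsub>?G\<^esub>" "\<one>\<^bsub>?G\<^esub>"] G.one_closed by simp
  have generator: "shift (g c) = ?\<Lambda> *v axis c 1" for c
    by (simp add: matrix_vector_mult_basis column_def lattice_matrix_def shift_def vec_eq_iff)
  have "\<exists>m. (\<forall>k. m $ k \<in> \<int>) \<and> shift \<gamma> = ?\<Lambda> *v m"
    using gens(2)
  proof (induction rule: generate.induct)
    case one
    show ?case using \<open>shift \<one>\<^bsub>?G\<^esub> = 0\<close> by (intro exI[of _ 0]) simp
  next
    case (incl h)
    then obtain c where "h = g c" by blast
    then show ?case
      using generator[of c] by (intro exI[of _ "axis c 1"]) (simp add: axis_def)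
  next
    case (inv h)
    then obtain c where h: "h = g c" by blast
    then have "h \<in> \<Gamma>" using gens by blast
    then have "shift h + shift (inv\<^bsub>?G\<^esub> h) = 0"
      using shift_mult[of h "inv\<^bsub>?G\<^esub> h"] one G.inv_closed[of h] by simp
    then have "shift (inv\<^bsub>?G\<^esub> h) = ?\<Lambda> *v - axis c 1"
      using generator[of c] h
        matrix_vector_mult_diff_distrib[of ?\<Lambda> 0 "axis c 1"]
      by (simp add: add_eq_0_iff)
    then show ?case
      by (intro exI[of _ "- axis c 1"]) (simp add: axis_def)
  next
    case (eng h1 h2)
    then obtain m1 m2 where m: "\<forall>k. m1 $ k \<in> \<int>" "\<forall>k. m2 $ k \<in> \<int>"
      "shift h1 = ?\<Lambda> *v m1" "shift h2 = ?\<Lambda> *v m2" by blast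
    have "h1 \<in> \<Gamma>" "h2 \<in> \<Gamma>"
      using eng G.generate_in_carrier[of "range g"] gens(1) by simp_all
    then show ?case
      using m by (intro exI[of _ "m1 + m2"]) (simp add: shift_mult matrix_vector_right_distrib)
  qed
  then show ?thesis using that by blast
qed

text \<open>Nonzero because the lattice matrix sends the edge vector to the difference of the positions of
  two adjacent vertices.\<close>

lemma ex_nonzero_edge_vector:
  assumes gen: "independent_generators V \<Gamma> g" and \<Lambda>: "\<Lambda> = lattice_matrix \<pi> g"
    and rep: "orbit_representatives V \<Gamma> n rep"
    and coord: "lattice_coordinates n \<Lambda> p rep q"
    and ij: "i < n" "j < n"
    and adj: "adjacent E u v"
    and u: "vertex_orbit V \<Gamma> u = vertex_orbit V \<Gamma> (rep i)"
    and v: "vertex_orbit V \<Gamma> v = vertex_orbit V \<Gamma> (rep j)"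
  obtains x where "x \<in> edge_vectors V E \<Gamma> p \<Lambda> rep q i j" "x \<noteq> 0"
proof -
  have V: "u \<in> V" "v \<in> V" using adjacent_in_V[OF adj] by auto
  have repV: "rep i \<in> V" "rep j \<in> V"
    using rep ij by (auto simp: orbit_representatives_def)
  then obtain \<gamma> where \<gamma>: "\<gamma> \<in> \<Gamma>" "rep i = \<gamma> u"
    using u vertex_orbit_self mem_vertex_orbit_iff by blast
  let ?w = "\<gamma> v"
  have adj': "adjacent E (rep i) ?w"
    using adjacent_action[OF \<gamma>(1) adj] \<gamma>(2) by simp
  have w: "?w \<in> vertex_orbit V \<Gamma> (rep j)"
    using vertex_orbit_self[OF action_closed[OF \<gamma>(1) V(2)]] vertex_orbit_action[OF \<gamma>(1) V(2)] v
    by simp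
  then obtain \<delta> where \<delta>: "\<delta> \<in> \<Gamma>" "?w = \<delta> (rep j)"
    using mem_vertex_orbit_iff by blast
  obtain m where m: "\<forall>k. m $ k \<in> \<int>" "shift \<delta> = \<Lambda> *v m"
    using shift_in_lattice[OF gen \<delta>(1)] \<Lambda> by blast
  have pw: "p ?w = p (rep j) + \<Lambda> *v m"
    using p_action[OF \<delta>(1) repV(2)] \<delta>(2) m(2) by simp
  let ?x = "q j + m - q i"
  have "?x \<in> edge_vectors V E \<Gamma> p \<Lambda> rep q i j"
    unfolding edge_vectors_def using m(1) w adj' pw by (auto intro!: exI[of _ m] exI[of _ ?w])
  moreover have "\<Lambda> *v ?x = p ?w - p (rep i)"
    using coord ij pw
    by (simp add: lattice_coordinates_def matrix_vector_right_distrib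
        matrix_vector_mult_diff_distrib)
  then have "?x \<noteq> 0"
    using nondegenerate[OF adj'] by auto
  ultimately show ?thesis using that by blast
qed

lemma linked_ex_nonzero_edge_vector:
  assumes gen: "independent_generators V \<Gamma> g" and \<Lambda>: "\<Lambda> = lattice_matrix \<pi> g"
    and rep: "orbit_representatives V \<Gamma> n rep"
    and coord: "lattice_coordinates n \<Lambda> p rep q"
    and linked: "linked V E \<Gamma> n rep i j"
  obtains x where "x \<in> edge_vectors V E \<Gamma> p \<Lambda> rep q i j" "x \<noteq> 0"
proof -
  note ij = linked[unfolded linked_def]
  let ?O = "vertex_orbit V \<Gamma>" and ?Q = "quotient_multigraph V E \<Gamma>"
  have "{?O (rep i), ?O (rep j)} \<in> ends ?Q ` medges ?Q"
    using ij unfolding adjacent_def reduced_quotient_edges_def by blast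
  then obtain \<epsilon> where \<epsilon>: "\<epsilon> \<in> medges ?Q" "{?O (rep i), ?O (rep j)} = ends ?Q \<epsilon>"
    by (rule imageE)
  from \<epsilon>(1) have "\<epsilon> \<in> edge_orbits V E \<Gamma>"
    by (simp add: quotient_multigraph_def)
  then obtain u v where uv: "adjacent E u v" "ends ?Q \<epsilon> = {?O u, ?O v}"
    by (rule edge_orbit_ends)
  have vu: "adjacent E v u"
    using uv(1) by (simp add: adjacent_def insert_commute)
  have n: "i < n" "j < n"
    using ij by simp_all
  note edge_vector = ex_nonzero_edge_vector[OF gen \<Lambda> rep coord n]
  have "{?O u, ?O v} = {?O (rep i), ?O (rep j)}"
    using \<epsilon>(2) uv(2) by simp
  then consider "?O u = ?O (rep i)" "?O v = ?O (rep j)" | "?O v = ?O (rep i)" "?O u = ?O (rep j)"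
    unfolding doubleton_eq_iff by blast
  then show ?thesis
  proof cases
    case 1
    show ?thesis by (rule edge_vector[OF uv(1) 1]) (rule that)
  next
    case 2
    show ?thesis by (rule edge_vector[OF vu 2]) (rule that)
  qed
qed

text \<open>The two ends of a loop have the same \<open>q'\<close>, which leaves only the quadratic part of the
  deformation equation, evaluated at a nonzero vector.\<close>

lemma no_loops:
  assumes gen: "independent_generators V \<Gamma> g" and \<Lambda>: "\<Lambda> = lattice_matrix \<pi> g"
    and rep: "orbit_representatives V \<Gamma> n rep"
    and coord: "lattice_coordinates n \<Lambda> p rep q"
    and auxetic: "strictly_auxetic n (edge_vectors V E \<Gamma> p \<Lambda> rep q) \<omega> q' \<omega>'"
  shows "\<not> is_loop (quotient_multigraph V E \<Gamma>) \<epsilon>"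
proof
  assume loop: "is_loop (quotient_multigraph V E \<Gamma>) \<epsilon>"
  then have "\<epsilon> \<in> edge_orbits V E \<Gamma>"
    by (simp add: is_loop_def quotient_multigraph_def)
  then obtain u v where uv: "adjacent E u v"
    "ends (quotient_multigraph V E \<Gamma>) \<epsilon> = {vertex_orbit V \<Gamma> u, vertex_orbit V \<Gamma> v}"
    by (rule edge_orbit_ends)
  then have same: "vertex_orbit V \<Gamma> v = vertex_orbit V \<Gamma> u"
    using loop by (auto simp: is_loop_def card_insert_if split: if_splits)
  have "vertex_orbit V \<Gamma> u \<in> vertex_orbits V \<Gamma>"
    using adjacent_in_V(1)[OF uv(1)] by (auto simp: vertex_orbits_def vertex_orbit_def orbits_def)
  also have "vertex_orbits V \<Gamma> = (\<lambda>i. vertex_orbit V \<Gamma> (rep i)) ` {..<n}"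
    using rep by (simp add: orbit_representatives_def bij_betw_def)
  finally obtain i where i: "i < n" "vertex_orbit V \<Gamma> u = vertex_orbit V \<Gamma> (rep i)"
    by blast
  have same': "vertex_orbit V \<Gamma> v = vertex_orbit V \<Gamma> (rep i)"
    using same i(2) by (rule trans)
  obtain x where x: "x \<in> edge_vectors V E \<Gamma> p \<Lambda> rep q i i" "x \<noteq> 0"
    by (rule ex_nonzero_edge_vector[OF gen \<Lambda> rep coord i(1) i(1) uv(1) i(2) same'])
  have "\<forall>i<n. \<forall>j<n. \<forall>x \<in> edge_vectors V E \<Gamma> p \<Lambda> rep q i j.
      (\<omega>' *v x) \<bullet> x + 2 * ((\<omega> *v (q' j - q' i)) \<bullet> x) = 0"
    using auxetic by (simp add: strictly_auxetic_def infinitesimal_deformation_def)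
  from this[rule_format, OF i(1) i(1) x(1)]
  have "(\<omega>' *v x) \<bullet> x + 2 * ((\<omega> *v (q' i - q' i)) \<bullet> x) = 0" .
  moreover have "(\<omega>' *v x) \<bullet> x > 0"
    using auxetic x(2) by (simp add: strictly_auxetic_def positive_definite_def)
  ultimately show False
    by simp
qed

end


section \<open>Level sets of a positive definite form\<close>

lemma positive_definite_imp_invertible:
  fixes A :: "real ^ 'd::finite ^ 'd"
  assumes "positive_definite A"
  shows "invertible A"
proof -
  have "x = 0" if "A *v x = 0" for x
    using assms that unfolding positive_definite_def by (metis inner_zero_left less_irrefl)
  then show ?thesis
    by (simp add: invertible_left_inverse matrix_left_invertible_ker)
qed

lemma symmetric_matrix_inner:
  fixes A :: "real ^ 'd::finite ^ 'd"
  assumes "symmetric_matrix A"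
  shows "(A *v x) \<bullet> y = (A *v y) \<bullet> x"
  using assms dot_lmul_matrix[of x A y]
  by (metis inner_commute symmetric_matrix_def transpose_matrix_vector)

text \<open>The level is the value of the form at the center because the quadric passes through the
  origin.\<close>

lemma edge_ellipsoid_eq_quadric:
  fixes \<omega> \<omega>' :: "real ^ 'd::finite ^ 'd" and q' :: "nat \<Rightarrow> real ^ 'd" and i j :: nat
  assumes pd: "positive_definite \<omega>'"
  defines "c \<equiv> edge_center \<omega> q' \<omega>' i j"
  shows "edge_ellipsoid \<omega> q' \<omega>' i j = {x. (\<omega>' *v (x - c)) \<bullet> (x - c) = (\<omega>' *v c) \<bullet> c}"
proof -
  have "\<omega>' ** matrix_inv \<omega>' = mat 1"
    unfolding matrix_inv_def
    by (rule someI2_ex[OF positive_definite_imp_invertible[OF pd, unfolded invertible_def]]) simp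
  then have c: "\<omega>' *v c = \<omega> *v (q' i - q' j)"
    by (simp add: c_def edge_center_def matrix_vector_mul_assoc matrix_mul_assoc)
  have lin: "\<omega> *v (q' j - q' i) = - (\<omega>' *v c)"
    unfolding c by (simp add: matrix_vector_mult_diff_distrib)
  have "(\<omega>' *v (x - c)) \<bullet> (x - c) = (\<omega>' *v x) \<bullet> x - 2 * ((\<omega>' *v c) \<bullet> x) + (\<omega>' *v c) \<bullet> c" for x
    using symmetric_matrix_inner[of \<omega>' x c] pd
    by (simp add: positive_definite_def matrix_vector_mult_diff_distrib inner_diff)
  then show ?thesis
    unfolding edge_ellipsoid_def lin by auto
qed

lemma is_ellipsoid_quadric:
  fixes A :: "real ^ 'd::finite ^ 'd"
  assumes pd: "positive_definite A" and r: "r > 0"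
  shows "is_ellipsoid {x. (A *v (x - c)) \<bullet> (x - c) = r} c"
proof -
  have "positive_definite ((1 / r) *\<^sub>R A)"
    using pd r
    by (auto simp: positive_definite_def symmetric_matrix_def transpose_scalar
        simp flip: scaleR_matrix_vector_assoc)
  moreover have "{x. (A *v (x - c)) \<bullet> (x - c) = r}
      = {x. ((1 / r) *\<^sub>R A *v (x - c)) \<bullet> (x - c) = 1}"
    using r by (auto simp: field_simps simp flip: scaleR_matrix_vector_assoc)
  ultimately show ?thesis
    unfolding is_ellipsoid_def by blast
qed

lemma homothetic_quadrics:
  fixes A :: "real ^ 'd::finite ^ 'd"
  assumes r: "r > 0" and s: "s > 0"
  shows "homothetic {x. (A *v (x - c)) \<bullet> (x - c) = r} {x. (A *v (x - c')) \<bullet> (x - c') = s}"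
proof -
  \<comment> \<open>The form is homogeneous of degree 2, so levels scale by the square of the ratio.\<close>
  define a where "a = sqrt (s / r)"
  define h where "h = (\<lambda>x. a *\<^sub>R x + (c' - a *\<^sub>R c))"
  have a: "a > 0" "a\<^sup>2 = s / r"
    using r s by (simp_all add: a_def)
  have form: "(A *v (h x - c')) \<bullet> (h x - c') = s / r * ((A *v (x - c)) \<bullet> (x - c))" for x
  proof -
    have "h x - c' = a *\<^sub>R (x - c)"
      by (simp add: h_def algebra_simps)
    then show ?thesis
      by (simp add: matrix_vector_mult_scaleR power2_eq_square flip: a(2))
  qed
  have surj: "h ((1 / a) *\<^sub>R (y - c') + c) = y" for y
    using a(1) by (simp add: h_def algebra_simps)
  have "{x. (A *v (x - c')) \<bullet> (x - c') = s} = h ` {x. (A *v (x - c)) \<bullet> (x - c) = r}"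
  proof (intro equalityI subsetI)
    fix y assume y: "y \<in> {x. (A *v (x - c')) \<bullet> (x - c') = s}"
    let ?x = "(1 / a) *\<^sub>R (y - c') + c"
    have "s / r * ((A *v (?x - c)) \<bullet> (?x - c)) = s"
      using form[of ?x] y unfolding surj by simp
    then have "(A *v (?x - c)) \<bullet> (?x - c) = r"
      using r s by (simp add: field_simps)
    then show "y \<in> h ` {x. (A *v (x - c)) \<bullet> (x - c) = r}"
      using surj[of y] by (intro image_eqI[of _ _ ?x]) auto
  next
    fix y assume "y \<in> h ` {x. (A *v (x - c)) \<bullet> (x - c) = r}"
    then show "y \<in> {x. (A *v (x - c')) \<bullet> (x - c') = s}"
      using form r by auto
  qed
  then show ?thesis
    unfolding homothetic_def h_def using a(1) by blast
qed

text \<open>A center at the origin would shrink the quadric to a point, leaving no room for a nonzero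
  vector.\<close>

lemma edge_center_form_pos:
  fixes \<omega> \<omega>' :: "real ^ 'd::finite ^ 'd" and q' :: "nat \<Rightarrow> real ^ 'd" and i j :: nat
  assumes pd: "positive_definite \<omega>'"
    and x: "x \<in> edge_ellipsoid \<omega> q' \<omega>' i j" "x \<noteq> 0"
  defines "c \<equiv> edge_center \<omega> q' \<omega>' i j"
  shows "(\<omega>' *v c) \<bullet> c > 0"
proof -
  have "c \<noteq> 0"
    using x pd unfolding edge_ellipsoid_eq_quadric[OF pd] c_def[symmetric]
    by (auto simp: positive_definite_def)
  then show ?thesis
    using pd by (simp add: positive_definite_def)
qed


section \<open>Centers along closed walks\<close>

lemma sum_cyclic_shift:
  "(\<Sum>k<N. f (Suc k mod N)) = (\<Sum>k<N. f k :: 'a::comm_monoid_add)"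
proof (cases N)
  case (Suc M)
  have "(\<Sum>k<Suc M. f (Suc k mod Suc M)) = (\<Sum>k<M. f (Suc k)) + f 0"
    by simp
  also have "\<dots> = (\<Sum>k<Suc M. f k)"
    by (subst sum.lessThan_Suc_shift) (simp add: add.commute)
  finally show ?thesis
    using Suc by simp
qed simp

lemma sum_edge_center_closed_walk:
  "(\<Sum>k<length js. edge_center \<omega> q' \<omega>' (js ! k) (js ! (Suc k mod length js))) = 0"
proof -
  define f where "f i = matrix_inv \<omega>' *v (\<omega> *v q' i)" for i
  have "edge_center \<omega> q' \<omega>' i j = f i - f j" for i j
    by (simp add: edge_center_def f_def matrix_vector_mult_diff_distrib)
  then show ?thesis
    using sum_cyclic_shift[of "\<lambda>k. f (js ! k)" "length js"] by (simp add: sum_subtractf)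
qed


section \<open>Strictly auxetic deformations\<close>

theorem mainTheorem2:
  fixes V :: "'v set" and E :: "'v set set" and \<Gamma> :: "('v \<Rightarrow> 'v) set"
    and p :: "'v \<Rightarrow> real ^ 'd::finite"
    and \<pi> :: "('v \<Rightarrow> 'v) \<Rightarrow> real ^ 'd \<Rightarrow> real ^ 'd"
    and g :: "'d \<Rightarrow> 'v \<Rightarrow> 'v"
    and n :: nat and rep :: "nat \<Rightarrow> 'v"
    and \<Lambda> \<omega> \<omega>' :: "real ^ 'd ^ 'd"
    and q q' :: "nat \<Rightarrow> real ^ 'd"
    and e :: "nat \<Rightarrow> nat \<Rightarrow> (real ^ 'd) set"
  assumes "CARD('d) \<ge> 2"
    and "periodic_framework V E \<Gamma> p \<pi>"
    and "independent_generators V \<Gamma> g"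
    and "\<Lambda> = lattice_matrix \<pi> g"
    and "\<omega> = transpose \<Lambda> ** \<Lambda>"
    and "orbit_representatives V \<Gamma> n rep"
    and "lattice_coordinates n \<Lambda> p rep q"
    and "e = edge_vectors V E \<Gamma> p \<Lambda> rep q"
    and "strictly_auxetic n e \<omega> q' \<omega>'"
  shows "(\<nexists>\<epsilon>. is_loop (quotient_multigraph V E \<Gamma>) \<epsilon>)
    \<and> (\<forall>i j. linked V E \<Gamma> n rep i j \<longrightarrow>
          e i j \<subseteq> edge_ellipsoid \<omega> q' \<omega>' i j \<and>
          0 \<in> edge_ellipsoid \<omega> q' \<omega>' i j \<and>
          is_ellipsoid (edge_ellipsoid \<omega> q' \<omega>' i j) (edge_center \<omega> q' \<omega>' i j))
    \<and> (\<forall>i j k l. linked V E \<Gamma> n rep i j \<longrightarrow> linked V E \<Gamma> n rep k l \<longrightarrow>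
          homothetic (edge_ellipsoid \<omega> q' \<omega>' i j) (edge_ellipsoid \<omega> q' \<omega>' k l))
    \<and> (\<forall>js. set js \<subseteq> {..<n} \<longrightarrow>
          is_cycle (reduced_quotient_edges V E \<Gamma>) (map (\<lambda>i. vertex_orbit V \<Gamma> (rep i)) js) \<longrightarrow>
          (\<Sum>k<length js. edge_center \<omega> q' \<omega>' (js ! k) (js ! (Suc k mod length js))) = 0)"
proof -
  interpret periodic_framework V E \<Gamma> p \<pi> by fact
  note e = \<open>e = edge_vectors V E \<Gamma> p \<Lambda> rep q\<close>
  have pd: "positive_definite \<omega>'"
    and deform: "infinitesimal_deformation n e \<omega> q' \<omega>'"
    using \<open>strictly_auxetic n e \<omega> q' \<omega>'\<close> by (simp_all add: strictly_auxetic_def)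
  let ?c = "edge_center \<omega> q' \<omega>'" and ?S = "edge_ellipsoid \<omega> q' \<omega>'"
  have on: "e i j \<subseteq> ?S i j" if "linked V E \<Gamma> n rep i j" for i j
    using that deform
    by (auto simp: linked_def infinitesimal_deformation_def edge_ellipsoid_def)
  have pos: "(\<omega>' *v ?c i j) \<bullet> ?c i j > 0" if l: "linked V E \<Gamma> n rep i j" for i j
  proof -
    obtain x where "x \<in> e i j" "x \<noteq> 0"
      using linked_ex_nonzero_edge_vector[OF assms(3,4,6,7) l] unfolding e .
    then show ?thesis
      using edge_center_form_pos[OF pd] on[OF l] by blast
  qed
  have "\<nexists>\<epsilon>. is_loop (quotient_multigraph V E \<Gamma>) \<epsilon>"
    using no_loops[OF assms(3,4,6,7)] assms(9) e by blast
  moreover have "0 \<in> ?S i j" for i j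
    by (simp add: edge_ellipsoid_def)
  moreover have "is_ellipsoid (?S i j) (?c i j)" if "linked V E \<Gamma> n rep i j" for i j
    unfolding edge_ellipsoid_eq_quadric[OF pd] by (rule is_ellipsoid_quadric[OF pd pos[OF that]])
  moreover have "homothetic (?S i j) (?S k l)"
    if "linked V E \<Gamma> n rep i j" "linked V E \<Gamma> n rep k l" for i j k l
    unfolding edge_ellipsoid_eq_quadric[OF pd]
    by (rule homothetic_quadrics[OF pos[OF that(1)] pos[OF that(2)]])
  ultimately show ?thesis
    using on sum_edge_center_closed_walk by blast
qed

end
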